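(* Let $n\ge1$ and let $\rho=\sum_{k=1}^n\rho_k\delta_{\lambda_k}$ and $\rho'=\sum_{k=1}^n\rho_k'\delta_{\lambda_k'}$ be biradial measures with supports of cardinality $n$, with points ordered as in the definition of biradial measures with finite support, with corresponding integers $m$ and $m'$. Then $\rho$ and $\rho'$ have the same Jacobi parameters if and only if all of the following hold: $$m=m';$$ $$\rho_k=\rho_k'\quad\text{when }2m+1\le k\le n;$$ $$\rho_{2k-1}+\rho_{2k}=\rho_{2k-1}'+\rho_{2k}'\quad\text{when }1\le k\le m;$$ $$\lambda_k=\lambda_k'\quad\text{when }2m+1\le k\le n;$$ $$|\lambda_{2k}|=|\lambda_{2k}'|\quad\text{when }1\le k\le m;$$ $$\rho_{2k-1}\lambda_{2k-1}+\rho_{2k}\lambda_{2k}=\rho_{2k-1}'\lambda_{2k-1}'+\rho_{2k}'\lambda_{2k}'\quad\text{when }1\le k\le m.$$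
   Context: A biradial measure with finite support (of cardinality $n$) is a measure $\rho=\sum_{k=1}^n\rho_k\delta_{\lambda_k}$ on $\mathbb{C}$ with $\rho_k>0$, $\sum_{k=1}^n\rho_k=1$, and $\lambda_1,\dots,\lambda_n\in\mathbb{C}$ distinct and such that any origin centred circle contains at most two of them. The points are ordered such that, for some integer $m\ge0$ (the number of pairs of equal modulus), $|\lambda_{2k-1}|=|\lambda_{2k}|$ for $k=1,\dots,m$; $|\lambda_{2k-1}|<|\lambda_{2k+1}|$ for $k=1,\dots,m-1$; and $|\lambda_{2m+1}|<|\lambda_{2m+2}|<\cdots<|\lambda_n|$. For integers $k\ge0$ define the monomials $\langle\lambda\rangle^k=|\lambda|^k$ if $k$ is even and $\langle\lambda\rangle^k=\lambda|\lambda|^{k-1}$ if $k$ is odd. For complex combinations $p,q$ of these monomials put $\langle p,q\rangle=\int_{\mathbb{C}}p\overline{q}\,d\rho=\sum_{k=1}^np(\lambda_k)\overline{q(\lambda_k)}\rho_k$. The monomials $1,\langle\lambda\rangle^1,\dots,\langle\lambda\rangle^{n-1}$ are linearly independent in $L^2(\rho)$, and Gram–Schmidt applied to them yields orthonormal polynomials $p_0,\dots,p_{n-1}$, where $p_j$ is a combination of $1,\dots,\langle\lambda\rangle^j$ with positive coefficient at $\langle\lambda\rangle^j$. The Jacobi parameters of $\rho$ are $\alpha_j=\langle\lambda\overline{p_{j-1}},p_{j-1}\rangle\in\mathbb{C}$ for $j=1,\dots,n$ and $\beta_j=\langle\lambda\overline{p_{j-1}},p_j\rangle>0$ for $j=1,\dots,n-1$;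 they satisfy $\beta_{j+1}p_{j+1}=\lambda\overline{p_j}-\alpha_{j+1}p_j-\beta_jp_{j-1}$ for $j=0,\dots,n-2$, with $p_{-1}\equiv0$. *)

theory Defs
  imports "HOL-Probability.Probability"
begin

text \<open>
  \<open>is_biradial n r lam \<rho>\<close>: \<open>\<rho>\<close> is the Borel measure with the atoms \<open>lam 1, \<dots>, lam n\<close> of masses
  \<open>r 1, \<dots>, r n\<close>; values of \<open>r\<close> and \<open>lam\<close> outside \<open>{1..n}\<close> are irrelevant.
  \<open>return borel z\<close> is the Dirac measure at \<open>z\<close>.  Injectivity makes the radius \<open>0\<close> harmless, so only
  proper circles are constrained.
\<close>

definition is_biradial ::
  "nat \<Rightarrow> (nat \<Rightarrow> real) \<Rightarrow> (nat \<Rightarrow> complex) \<Rightarrow> complex measure \<Rightarrow> bool" where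
  "is_biradial n r lam \<rho> \<longleftrightarrow>
     sets \<rho> = sets borel \<and>
     (\<forall>A\<in>sets borel. emeasure \<rho> A = (\<Sum>k=1..n. ennreal (r k) * emeasure (return borel (lam k)) A)) \<and>
     (\<forall>k\<in>{1..n}. 0 < r k) \<and>
     (\<Sum>k=1..n. r k) = 1 \<and>
     inj_on lam {1..n} \<and>
     (\<forall>R>0. card (lam ` {1..n} \<inter> sphere 0 R) \<le> 2)"

text \<open>
  For the points of a biradial measure these conditions force \<open>m\<close> to be the number of pairs of
  points of equal modulus: a third point on the circle of a pair is excluded by \<open>is_biradial\<close>.
\<close>

definition modulus_ordered :: "nat \<Rightarrow> nat \<Rightarrow> (nat \<Rightarrow> complex) \<Rightarrow> bool" where
  "modulus_ordered n m lam \<longleftrightarrow>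
     2 * m \<le> n \<and>
     (\<forall>k. 1 \<le> k \<and> k \<le> m \<longrightarrow> cmod (lam (2 * k - 1)) = cmod (lam (2 * k))) \<and>
     (\<forall>k. 1 \<le> k \<and> k < m \<longrightarrow> cmod (lam (2 * k - 1)) < cmod (lam (2 * k + 1))) \<and>
     (\<forall>k. 2 * m + 1 \<le> k \<and> k < n \<longrightarrow> cmod (lam k) < cmod (lam (k + 1)))"

definition amonom :: "nat \<Rightarrow> complex \<Rightarrow> complex" where
  "amonom k z =
     (if even k then complex_of_real (cmod z ^ k) else z * complex_of_real (cmod z ^ (k - 1)))"

definition inner_L2 ::
  "complex measure \<Rightarrow> (complex \<Rightarrow> complex) \<Rightarrow> (complex \<Rightarrow> complex) \<Rightarrow> complex" where
  "inner_L2 \<rho> p q = (LINT z|\<rho>. p z * cnj (q z))"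

text \<open>
  Gram--Schmidt.  The coefficient of \<open>ortho_poly \<rho> j\<close> at \<open>amonom j\<close> is the reciprocal of a norm,
  hence positive as long as \<open>amonom 0, \<dots>, amonom j\<close> are linearly independent in \<open>L\<^sup>2(\<rho>)\<close>.  For
  measures with \<open>n\<close> atoms the values are meaningful for \<open>j < n\<close> only.
\<close>

fun ortho_poly :: "complex measure \<Rightarrow> nat \<Rightarrow> complex \<Rightarrow> complex" where
  "ortho_poly \<rho> j =
     (let q = (\<lambda>z. amonom j z -
                 (\<Sum>i<j. inner_L2 \<rho> (amonom j) (ortho_poly \<rho> i) * ortho_poly \<rho> i z))
      in (\<lambda>z. q z / complex_of_real (sqrt (Re (inner_L2 \<rho> q q)))))"

declare ortho_poly.simps [simp del]

text \<open>
  Indexed from \<open>j = 1\<close>.  The numbers \<open>jacobi_beta \<rho> j\<close> are positive reals for \<open>1 \<le> j < n\<close>, but are kept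
  as complex numbers, being inner products.
\<close>

definition jacobi_alpha :: "complex measure \<Rightarrow> nat \<Rightarrow> complex" where
  "jacobi_alpha \<rho> j = inner_L2 \<rho> (\<lambda>z. z * cnj (ortho_poly \<rho> (j - 1) z)) (ortho_poly \<rho> (j - 1))"

definition jacobi_beta :: "complex measure \<Rightarrow> nat \<Rightarrow> complex" where
  "jacobi_beta \<rho> j = inner_L2 \<rho> (\<lambda>z. z * cnj (ortho_poly \<rho> (j - 1) z)) (ortho_poly \<rho> j)"

end

theory Submission
  imports Defs
begin

text \<open>
  Both sides are equivalent to the equality of all integrals of \<open>a |z|\<close> and \<open>z * a |z|\<close>, for arbitrary
  \<open>a\<close>, against the two measures.

  The map \<open>f \<mapsto> z * cnj f\<close> is antilinear and sends each monomial to the next one.  Its matrix in the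
  orthonormal basis \<open>p\<^sub>0, \<dots>, p\<^sub>n\<^sub>-\<^sub>1\<close> has the entries \<open>\<integral> z * cnj p\<^sub>i * cnj p\<^sub>j\<close>, hence is symmetric, and
  therefore tridiagonal; so it consists of the Jacobi parameters.  Iterating it on the constant
  \<open>1\<close> recovers the moments, and interpolation in \<open>|z|\<^sup>2\<close> passes from the moments to the integrals
  above.  Conversely, these integrals determine every inner product of two functions of the form
  \<open>a |z| + z * b |z|\<close>, and with them the whole Gram--Schmidt process.

  Finally, the integrals amount to the mass and the first moment on each origin centred circle.
  By strict convexity the first moment on the circle of radius \<open>R\<close> is smaller than \<open>R\<close> times the
  mass precisely when the circle carries two atoms.
\<close>

section \<open>Gram--Schmidt residuals and the monomials\<close>

text \<open>The Gram--Schmidt vector before normalisation, extracted from the \<open>let\<close> in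
  \<open>ortho_poly\<close> so that its norm can be tested for zero.\<close>

definition gs_residual :: "complex measure \<Rightarrow> nat \<Rightarrow> complex \<Rightarrow> complex" where
  "gs_residual \<rho> j z =
     amonom j z - (\<Sum>i<j. inner_L2 \<rho> (amonom j) (ortho_poly \<rho> i) * ortho_poly \<rho> i z)"

lemma ortho_poly_eq_residual:
  "ortho_poly \<rho> j z =
     gs_residual \<rho> j z /
       complex_of_real (sqrt (Re (inner_L2 \<rho> (gs_residual \<rho> j) (gs_residual \<rho> j))))"
proof -
  have "gs_residual \<rho> j = (\<lambda>z. amonom j z -
     (\<Sum>i<j. inner_L2 \<rho> (amonom j) (ortho_poly \<rho> i) * ortho_poly \<rho> i z))"
    by (simp add: gs_residual_def fun_eq_iff)
  then show ?thesis
    by (subst ortho_poly.simps) (simp add: Let_def)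
qed

lemma amonom_0 [simp]: "amonom 0 z = 1"
  by (simp add: amonom_def)

text \<open>Even monomials are real, so conjugation leaves them alone; for odd \<open>k\<close> the
  factor \<open>z * cnj z\<close> becomes \<open>(cmod z)\<^sup>2\<close>. This is the shift by one
  degree on which the induction over moments rests.\<close>

lemma mult_cnj_amonom: "z * cnj (amonom k z) = amonom (Suc k) z"
proof (cases "even k")
  case False
  then obtain l where k: "k = Suc l" by (cases k) auto
  have "z * cnj (z * complex_of_real (cmod z ^ l)) = (z * cnj z) * complex_of_real (cmod z ^ l)"
    by (simp add: mult.assoc)
  also have "\<dots> = complex_of_real (cmod z ^ Suc k)"
    by (simp only: complex_norm_square [symmetric] flip: of_real_mult power_add) (simp add: k)
  finally show ?thesis
    using False by (simp add: amonom_def k)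
qed (simp add: amonom_def)

lemma amonom_even: "amonom (2 * i) z = (complex_of_real ((cmod z)\<^sup>2)) ^ i"
  by (simp add: amonom_def power_mult)

lemma amonom_odd: "amonom (Suc (2 * i)) z = z * (complex_of_real ((cmod z)\<^sup>2)) ^ i"
  by (simp add: amonom_def power_mult)

text \<open>Together with its odd counterpart, this turns polynomial interpolation in the squared
  modulus into statements about monomials.\<close>

lemma poly_square_eq_sum_amonom:
  "poly P (complex_of_real ((cmod z)\<^sup>2)) = (\<Sum>i\<le>degree P. coeff P i * amonom (2 * i) z)"
  unfolding amonom_even by (simp add: poly_altdef)

lemma mult_poly_square_eq_sum_amonom:
  "z * poly P (complex_of_real ((cmod z)\<^sup>2)) =
     (\<Sum>i\<le>degree P. coeff P i * amonom (Suc (2 * i)) z)"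
  unfolding amonom_odd by (simp add: poly_altdef sum_distrib_left mult.left_commute)

lemma amonom_measurable [measurable]: "amonom k \<in> borel_measurable borel"
  unfolding amonom_def by simp

lemma ortho_poly_measurable [measurable]: "ortho_poly \<rho> j \<in> borel_measurable borel"
proof (induction j rule: less_induct)
  case (less j)
  then have "gs_residual \<rho> j \<in> borel_measurable borel"
    unfolding gs_residual_def by (intro borel_measurable_diff borel_measurable_sum
      borel_measurable_times borel_measurable_const) auto
  then show ?case
    unfolding ortho_poly_eq_residual [abs_def] by simp
qed

lemma gs_residual_measurable [measurable]: "gs_residual \<rho> j \<in> borel_measurable borel"
  unfolding gs_residual_def by simp

section \<open>Functions affine in \<open>z\<close> with radial coefficients\<close>

text \<open>A class containing the monomials and closed under all operations of Gram--Schmidt and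
  under \<open>f \<mapsto> z * cnj f\<close>. Measurability is required separately because
  \<open>a\<close> and \<open>b\<close> are arbitrary.\<close>

definition radial_affine :: "(complex \<Rightarrow> complex) \<Rightarrow> bool" where
  "radial_affine f \<longleftrightarrow> f \<in> borel_measurable borel \<and>
     (\<exists>a b :: real \<Rightarrow> complex. \<forall>z. f z = a (cmod z) + z * b (cmod z))"

lemma radial_affineI:
  fixes a b :: "real \<Rightarrow> complex"
  assumes "f \<in> borel_measurable borel" "\<And>z. f z = a (cmod z) + z * b (cmod z)"
  shows "radial_affine f"
  using assms by (auto simp: radial_affine_def)

lemma radial_affine_amonom: "radial_affine (amonom k)"
  by (rule radial_affineI [where a = "\<lambda>x. if even k then complex_of_real (x ^ k) else 0"
        and b = "\<lambda>x. if even k then 0 else complex_of_real (x ^ (k - 1))"])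
    (auto simp: amonom_def)

lemma radial_affine_scale:
  assumes "radial_affine f"
  shows "radial_affine (\<lambda>z. c * f z)"
proof -
  obtain a b where "f \<in> borel_measurable borel" "\<And>z. f z = a (cmod z) + z * b (cmod z)"
    using assms by (auto simp: radial_affine_def)
  note f = this
  show ?thesis
  proof (rule radial_affineI [where a = "\<lambda>x. c * a x" and b = "\<lambda>x. c * b x"])
    show "(\<lambda>z. c * f z) \<in> borel_measurable borel"
      using f(1) by (intro borel_measurable_times) auto
  qed (simp add: f(2) algebra_simps)
qed

lemma radial_affine_add:
  assumes "radial_affine f" "radial_affine g"
  shows "radial_affine (\<lambda>z. f z + g z)"
proof -
  obtain a b where f: "f \<in> borel_measurable borel" "\<And>z. f z = a (cmod z) + z * b (cmod z)"
    using assms by (auto simp: radial_affine_def)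
  obtain a' b' where g: "g \<in> borel_measurable borel" "\<And>z. g z = a' (cmod z) + z * b' (cmod z)"
    using assms by (auto simp: radial_affine_def)
  show ?thesis
  proof (rule radial_affineI [where a = "\<lambda>x. a x + a' x" and b = "\<lambda>x. b x + b' x"])
    show "(\<lambda>z. f z + g z) \<in> borel_measurable borel"
      using f(1) g(1) by (rule borel_measurable_add)
  qed (simp add: f(2) g(2) algebra_simps)
qed

lemma radial_affine_sum:
  "finite A \<Longrightarrow> (\<And>i. i \<in> A \<Longrightarrow> radial_affine (f i)) \<Longrightarrow> radial_affine (\<lambda>z. \<Sum>i\<in>A. f i z)"
proof (induction A rule: finite_induct)
  case empty
  then show ?case by (intro radial_affineI [where a = "\<lambda>_. 0" and b = "\<lambda>_. 0"]) auto
qed (simp add: radial_affine_add)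

text \<open>Since \<open>z * cnj z\<close> is radial, the two coefficients exchange their roles, up
  to conjugation and a factor \<open>(cmod z)\<^sup>2\<close>.\<close>

lemma radial_affine_mult_cnj:
  assumes "radial_affine f"
  shows "radial_affine (\<lambda>z. z * cnj (f z))"
proof -
  obtain a b where f: "f \<in> borel_measurable borel" "\<And>z. f z = a (cmod z) + z * b (cmod z)"
    using assms by (auto simp: radial_affine_def)
  show ?thesis
  proof (rule radial_affineI [where a = "\<lambda>x. complex_of_real (x\<^sup>2) * cnj (b x)" and b = "\<lambda>x. cnj (a x)"])
    show "(\<lambda>z. z * cnj (f z)) \<in> borel_measurable borel"
      by (intro borel_measurable_times measurable_compose [OF f(1)])
        (auto intro!: borel_measurable_continuous_onI continuous_intros)
  qed (simp add: f(2) complex_norm_square algebra_simps del: of_real_power)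
qed

lemma radial_affine_residual: "radial_affine (gs_residual \<rho> j)"
  and radial_affine_ortho_poly: "radial_affine (ortho_poly \<rho> j)"
proof -
  \<comment> \<open>The inner products enter as mere constants, so nothing about the measure is
    used. The premise on smaller indices lets the fact serve inside the induction and after
    it.\<close>
  have *: "radial_affine (gs_residual \<rho> j)" if "\<And>i. i < j \<Longrightarrow> radial_affine (ortho_poly \<rho> i)" for j
  proof -
    have "radial_affine (\<lambda>z. amonom j z + (-1) * (\<Sum>i<j. inner_L2 \<rho> (amonom j) (ortho_poly \<rho> i) * ortho_poly \<rho> i z))"
      using that by (intro radial_affine_add radial_affine_scale radial_affine_sum radial_affine_amonom) auto
    then show ?thesis by (simp add: gs_residual_def [abs_def])
  qed
  show **: "radial_affine (ortho_poly \<rho> j)" for j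
  proof (induction j rule: less_induct)
    case (less j)
    show ?case
      unfolding ortho_poly_eq_residual [abs_def] divide_inverse mult.commute [of "gs_residual \<rho> j _"]
      using less by (intro radial_affine_scale *)
  qed
  show "radial_affine (gs_residual \<rho> j)"
    by (intro * **)
qed

section \<open>Interpolation and increasing enumerations\<close>

text \<open>Newton interpolation: a multiple of the polynomial \<open>Q\<close> vanishing on the old
  nodes corrects the value at the new one.\<close>

lemma poly_interpolation:
  fixes a :: "'a::field \<Rightarrow> 'a"
  assumes "finite X"
  shows "\<exists>P. \<forall>x\<in>X. poly P x = a x"
  using assms
proof (induction X)
  case (insert x X)
  then obtain P where P: "\<forall>y\<in>X. poly P y = a y" by blast
  define Q where "Q = (\<Prod>y\<in>X. [:- y, 1:])"
  have Q: "poly Q y = 0" if "y \<in> X" for y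
    using that insert.hyps by (auto simp: Q_def poly_prod)
  have Qx: "poly Q x \<noteq> 0"
    using insert.hyps by (auto simp: Q_def poly_prod)
  show ?case
    by (rule exI [of _ "P + smult ((a x - poly P x) / poly Q x) Q"]) (use P Q Qx in auto)
qed simp

text \<open>A nonnegative \<open>x\<close> is recovered from the node \<open>x\<^sup>2\<close> by
  the square root, so prescribing values at the squared nodes is consistent.\<close>

lemma poly_interpolation_square:
  fixes a :: "real \<Rightarrow> complex"
  assumes "finite X" "\<forall>x\<in>X. 0 \<le> x"
  obtains P where "\<And>x. x \<in> X \<Longrightarrow> poly P (complex_of_real (x\<^sup>2)) = a x"
proof -
  obtain P where "\<forall>y\<in>(\<lambda>x. complex_of_real (x\<^sup>2)) ` X. poly P y = a (sqrt (Re y))"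
    using poly_interpolation [of "(\<lambda>x. complex_of_real (x\<^sup>2)) ` X" "\<lambda>y. a (sqrt (Re y))"] assms(1)
    by blast
  then show thesis using assms(2) by (intro that [of P]) (auto simp flip: of_real_power)
qed

text \<open>Both value lists are sorted, distinct and have the same set. It serves to recover radii
  index by index from the set of radii.\<close>

lemma strict_mono_enumeration_unique:
  fixes f g :: "nat \<Rightarrow> 'a::linorder"
  assumes "strict_mono_on {a..b} f" "strict_mono_on {a..b} g" "f ` {a..b} = g ` {a..b}"
    and "k \<in> {a..b}"
  shows "f k = g k"
proof -
  have *: "sorted (map h [a..<Suc b]) \<and> distinct (map h [a..<Suc b])"
    if "strict_mono_on {a..b} h" for h :: "nat \<Rightarrow> 'a"
  proof -
    have "inj_on h {a..b}" "mono_on {a..b} h"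
      using that by (auto simp: strict_mono_on_imp_inj_on strict_mono_on_imp_mono_on)
    then show ?thesis
      by (auto simp: distinct_map sorted_wrt_map atLeastLessThanSuc_atLeastAtMost mono_on_def
          simp del: upt_Suc intro!: sorted_wrt_mono_rel [OF _ sorted_upt])
  qed
  have "map f [a..<Suc b] = map g [a..<Suc b]"
    using * [OF assms(1)] * [OF assms(2)] assms(3)
    by (intro sorted_distinct_set_unique)
      (auto simp: atLeastLessThanSuc_atLeastAtMost simp del: upt_Suc)
  then show ?thesis
    using assms(4) by (auto simp del: upt_Suc)
qed

section \<open>The inner product of a biradial measure as a finite sum\<close>

locale biradial =
  fixes n :: nat and r :: "nat \<Rightarrow> real" and lam :: "nat \<Rightarrow> complex" and \<rho> :: "complex measure"
  assumes is_biradial: "is_biradial n r lam \<rho>"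
begin

lemma weight_pos: "k \<in> {1..n} \<Longrightarrow> 0 < r k"
  and weight_sum: "(\<Sum>k=1..n. r k) = 1"
  and inj_lam: "inj_on lam {1..n}"
  and card_circle: "0 < R \<Longrightarrow> card (lam ` {1..n} \<inter> sphere 0 R) \<le> 2"
  and sets_rho: "sets \<rho> = sets borel"
  using is_biradial by (auto simp: is_biradial_def)

text \<open>As the image of a point measure on the indices, \<rho> has integrals that are finite
  sums.\<close>

lemma measure_eq_distr: "\<rho> = distr (point_measure {1..n} (\<lambda>k. ennreal (r k))) borel lam"
proof (rule measure_eqI)
  fix A assume "A \<in> sets \<rho>"
  then have A: "A \<in> sets borel" by (simp add: sets_rho)
  have "emeasure \<rho> A = (\<Sum>k=1..n. ennreal (r k) * emeasure (return borel (lam k)) A)"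
    using is_biradial A by (auto simp: is_biradial_def)
  also have "\<dots> = (\<Sum>k=1..n. if lam k \<in> A then ennreal (r k) else 0)"
    using A by (intro sum.cong) (auto simp: indicator_def)
  also have "\<dots> = (\<Sum>k\<in>lam -` A \<inter> {1..n}. ennreal (r k))"
    by (simp add: sum.inter_filter [symmetric] vimage_def Int_def conj_commute)
  also have "\<dots> = emeasure (distr (point_measure {1..n} (\<lambda>k. ennreal (r k))) borel lam) A"
    using A by (subst emeasure_distr)
      (auto simp: space_point_measure emeasure_point_measure_finite measurable_point_measure_eq1)
  finally show "emeasure \<rho> A = \<dots>" .
qed (simp add: sets_rho)

text \<open>Agrees with \<open>inner_L2 \<rho>\<close> on Borel functions, but its algebraic rules
  carry no measurability conditions.\<close>

definition ip :: "(complex \<Rightarrow> complex) \<Rightarrow> (complex \<Rightarrow> complex) \<Rightarrow> complex" where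
  "ip f g = (\<Sum>k=1..n. complex_of_real (r k) * (f (lam k) * cnj (g (lam k))))"

lemma inner_L2_eq_ip:
  assumes "f \<in> borel_measurable borel" "g \<in> borel_measurable borel"
  shows "inner_L2 \<rho> f g = ip f g"
proof -
  have cnj_g: "(\<lambda>z. cnj (g z)) \<in> borel_measurable borel"
    by (rule measurable_compose [OF assms(2)]) (intro borel_measurable_continuous_onI continuous_intros)
  have "inner_L2 \<rho> f g = (\<integral>k. f (lam k) * cnj (g (lam k)) \<partial>point_measure {1..n} (\<lambda>k. ennreal (r k)))"
    unfolding inner_L2_def using cnj_g assms(1)
    by (subst measure_eq_distr, subst integral_distr)
      (auto simp: measurable_point_measure_eq1 intro: borel_measurable_times)
  also have "\<dots> = ip f g"
    using weight_pos
    by (subst lebesgue_integral_point_measure_finite)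
      (auto simp: ip_def scaleR_conv_of_real less_imp_le)
  finally show ?thesis .
qed

lemma ip_cong:
  assumes "\<And>k. k \<in> {1..n} \<Longrightarrow> f (lam k) = f' (lam k)" "\<And>k. k \<in> {1..n} \<Longrightarrow> g (lam k) = g' (lam k)"
  shows "ip f g = ip f' g'"
  using assms by (simp add: ip_def)

lemma ip_scale: "ip (\<lambda>z. c * f z) g = c * ip f g"
  by (simp add: ip_def sum_distrib_left algebra_simps)

lemma ip_sum: "ip (\<lambda>z. \<Sum>i\<in>A. f i z) g = (\<Sum>i\<in>A. ip (f i) g)"
  unfolding ip_def by (subst sum.swap) (simp add: sum_distrib_left sum_distrib_right)

lemma ip_diff: "ip (\<lambda>z. f z - g z) h = ip f h - ip g h"
  by (simp add: ip_def sum_subtractf algebra_simps)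

lemma ip_cnj: "cnj (ip f g) = ip g f"
  by (simp add: ip_def mult.commute)

text \<open>Both sides integrate \<open>z * cnj (f z) * cnj (g z)\<close>. The matrix of
  \<open>f \<mapsto> z * cnj f\<close> is therefore symmetric rather than Hermitian.\<close>

lemma ip_mult_cnj_sym: "ip (\<lambda>z. z * cnj (f z)) g = ip (\<lambda>z. z * cnj (g z)) f"
  by (simp add: ip_def mult_ac)

lemma ip_self: "ip f f = complex_of_real (\<Sum>k=1..n. r k * (cmod (f (lam k)))\<^sup>2)"
  by (simp add: ip_def complex_norm_square del: of_real_power)

lemma ip_self_nonneg: "0 \<le> Re (ip f f)"
  using weight_pos by (auto simp: ip_self less_imp_le intro!: sum_nonneg)

lemma ip_self_eq_0:
  assumes "Re (ip f f) = 0" "k \<in> {1..n}"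
  shows "f (lam k) = 0"
proof -
  have "(\<Sum>k=1..n. r k * (cmod (f (lam k)))\<^sup>2) = 0"
    using assms(1) by (simp add: ip_self)
  then have "r k * (cmod (f (lam k)))\<^sup>2 = 0"
    using assms(2) weight_pos by (subst (asm) sum_nonneg_eq_0_iff) (auto simp: less_imp_le)
  then show ?thesis using weight_pos [OF assms(2)] by simp
qed

definition point_ind :: "nat \<Rightarrow> complex \<Rightarrow> complex" where
  "point_ind k z = (if z = lam k then 1 else 0)"

lemma sum_point_ind:
  fixes g :: "nat \<Rightarrow> complex"
  assumes "i \<in> {1..n}"
  shows "(\<Sum>k=1..n. g k * point_ind k (lam i)) = g i"
proof -
  have "(\<Sum>k=1..n. g k * point_ind k (lam i)) = (\<Sum>k=1..n. if k = i then g i else 0)"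
    unfolding point_ind_def using inj_onD [OF inj_lam] assms by (intro sum.cong) auto
  then show ?thesis using assms by simp
qed

lemma ip_point_ind:
  assumes "k \<in> {1..n}"
  shows "ip (point_ind k) f = complex_of_real (r k) * cnj (f (lam k))"
proof -
  have "ip (point_ind k) f = (\<Sum>i=1..n. if i = k then complex_of_real (r k) * cnj (f (lam k)) else 0)"
    unfolding ip_def point_ind_def using inj_onD [OF inj_lam] assms by (intro sum.cong) auto
  then show ?thesis using assms by simp
qed

section \<open>Expansion in the Gram--Schmidt functions\<close>

text \<open>For orthonormal functions this is membership in their span inside the L2 space, hence
  equality is asked for at the atoms only.\<close>

definition expands :: "nat \<Rightarrow> (complex \<Rightarrow> complex) \<Rightarrow> bool" where
  "expands N f \<longleftrightarrow>
     (\<forall>k\<in>{1..n}. f (lam k) = (\<Sum>j<N. ip f (ortho_poly \<rho> j) * ortho_poly \<rho> j (lam k)))"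

lemma expands_cong:
  assumes "expands N f" "\<And>k. k \<in> {1..n} \<Longrightarrow> g (lam k) = f (lam k)"
  shows "expands N g"
proof -
  have "ip g h = ip f h" for h using assms(2) by (intro ip_cong) auto
  with assms show ?thesis by (simp add: expands_def)
qed

lemma expands_sum:
  assumes "\<And>i. i \<in> A \<Longrightarrow> expands N (f i)"
  shows "expands N (\<lambda>z. \<Sum>i\<in>A. c i * f i z)"
  unfolding expands_def
proof
  fix k assume k: "k \<in> {1..n}"
  have "(\<Sum>j<N. ip (\<lambda>z. \<Sum>i\<in>A. c i * f i z) (ortho_poly \<rho> j) * ortho_poly \<rho> j (lam k))
      = (\<Sum>i\<in>A. c i * (\<Sum>j<N. ip (f i) (ortho_poly \<rho> j) * ortho_poly \<rho> j (lam k)))"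
    by (subst sum_distrib_left, subst sum.swap)
      (simp add: ip_sum ip_scale sum_distrib_right mult.assoc)
  also have "\<dots> = (\<Sum>i\<in>A. c i * f i (lam k))"
    using assms k by (intro sum.cong) (auto simp: expands_def)
  finally show "(\<Sum>i\<in>A. c i * f i (lam k)) =
    (\<Sum>j<N. ip (\<lambda>z. \<Sum>i\<in>A. c i * f i z) (ortho_poly \<rho> j) * ortho_poly \<rho> j (lam k))" ..
qed

lemma expands_scale: "expands N f \<Longrightarrow> expands N (\<lambda>z. c * f z)"
  using expands_sum [of "{0::nat}" N "\<lambda>_. f" "\<lambda>_. c"] by simp

lemma expands_add: "expands N f \<Longrightarrow> expands N g \<Longrightarrow> expands N (\<lambda>z. f z + g z)"
  using expands_sum [of "{True, False}" N "\<lambda>b. if b then f else g" "\<lambda>_. 1"] by simp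

lemma expands_diff: "expands N f \<Longrightarrow> expands N g \<Longrightarrow> expands N (\<lambda>z. f z - g z)"
  using expands_add [of N f, OF _ expands_scale [of N g "-1"]] by simp

definition res_norm :: "nat \<Rightarrow> real" where
  "res_norm j = sqrt (Re (ip (gs_residual \<rho> j) (gs_residual \<rho> j)))"

lemma res_norm_nonneg: "0 \<le> res_norm j"
  by (simp add: res_norm_def ip_self_nonneg)

lemma ortho_poly_eq: "ortho_poly \<rho> j z = gs_residual \<rho> j z / complex_of_real (res_norm j)"
  unfolding ortho_poly_eq_residual [of \<rho> j z] res_norm_def
  by (simp only: inner_L2_eq_ip gs_residual_measurable)

lemma gs_residual_eq:
  "gs_residual \<rho> j z =
     amonom j z - (\<Sum>i<j. ip (amonom j) (ortho_poly \<rho> i) * ortho_poly \<rho> i z)"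
  unfolding gs_residual_def
  by (simp only: inner_L2_eq_ip amonom_measurable ortho_poly_measurable)

text \<open>If the norm were \<open>0\<close>, division by zero would make
  \<open>ortho_poly \<rho> j\<close> vanish everywhere, whereas the residual is then known to vanish
  at the atoms only.\<close>

lemma amonom_eq:
  assumes "0 < res_norm j"
  shows "amonom j z = complex_of_real (res_norm j) * ortho_poly \<rho> j z +
     (\<Sum>i<j. ip (amonom j) (ortho_poly \<rho> i) * ortho_poly \<rho> i z)"
  using assms by (simp add: ortho_poly_eq [of j] gs_residual_eq [of j])

lemma res_norm_0: "res_norm 0 = 1"
  using weight_sum by (simp add: res_norm_def gs_residual_eq ip_def flip: of_real_sum)

lemma ortho_poly_0: "ortho_poly \<rho> 0 = (\<lambda>z. 1)"
proof
  show "ortho_poly \<rho> 0 z = 1" for z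
    unfolding ortho_poly_eq [of 0] res_norm_0 gs_residual_eq by simp
qed

text \<open>Applies the antilinear map to the Gram--Schmidt formula, which reduces the image of one
  function to the next monomial and the images of earlier functions.\<close>

lemma mult_cnj_ortho_poly:
  "z * cnj (ortho_poly \<rho> j z) = inverse (complex_of_real (res_norm j)) *
     (amonom (Suc j) z - (\<Sum>i<j. cnj (ip (amonom j) (ortho_poly \<rho> i)) * (z * cnj (ortho_poly \<rho> i z))))"
proof -
  have "cnj (gs_residual \<rho> j z) =
      cnj (amonom j z) - (\<Sum>i<j. cnj (ip (amonom j) (ortho_poly \<rho> i)) * cnj (ortho_poly \<rho> i z))"
    by (simp add: gs_residual_eq [of j])
  then have "z * cnj (gs_residual \<rho> j z) = amonom (Suc j) z
      - (\<Sum>i<j. cnj (ip (amonom j) (ortho_poly \<rho> i)) * (z * cnj (ortho_poly \<rho> i z)))"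
    by (simp only: right_diff_distrib mult_cnj_amonom sum_distrib_left mult.left_commute)
  then show ?thesis
    by (simp add: ortho_poly_eq [of j] divide_inverse mult.left_commute mult.commute)
qed

section \<open>Orthonormality as long as the residuals do not vanish\<close>

context
  fixes N :: nat
  assumes res_pos: "\<And>j. j < N \<Longrightarrow> 0 < res_norm j"
begin

lemma ortho_poly_norm: 
  assumes "j < N"
  shows "ip (ortho_poly \<rho> j) (ortho_poly \<rho> j) = 1"
proof -
  have "ip (ortho_poly \<rho> j) (ortho_poly \<rho> j)
      = complex_of_real ((\<Sum>k=1..n. r k * (cmod (gs_residual \<rho> j (lam k)))\<^sup>2) / (res_norm j)\<^sup>2)"
    unfolding ip_self ortho_poly_eq norm_divide
    by (simp add: power_divide sum_divide_distrib)
  also have "(\<Sum>k=1..n. r k * (cmod (gs_residual \<rho> j (lam k)))\<^sup>2) = (res_norm j)\<^sup>2"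
    unfolding res_norm_def using ip_self_nonneg [of "gs_residual \<rho> j"] by (simp add: ip_self)
  also have "\<dots> / (res_norm j)\<^sup>2 = 1"
    using res_pos [OF assms] by simp
  finally show ?thesis by simp
qed

lemma ortho_poly_orthogonal_less:
  "i < j \<Longrightarrow> j < N \<Longrightarrow> ip (ortho_poly \<rho> j) (ortho_poly \<rho> i) = 0"
proof (induction j arbitrary: i rule: less_induct)
  case (less j)
  \<comment> \<open>The induction hypothesis has the larger index on the left; the opposite order
    follows by conjugation.\<close>
  have orth: "ip (ortho_poly \<rho> l) (ortho_poly \<rho> i) = (if l = i then 1 else 0)" if "l < j" for l
  proof (cases l i rule: linorder_cases)
    case less': less
    then have "ip (ortho_poly \<rho> i) (ortho_poly \<rho> l) = 0"
      using less.IH [of i l] less.prems by simp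
    then show ?thesis
      using less' ip_cnj [of "ortho_poly \<rho> i" "ortho_poly \<rho> l"] by simp
  qed (use less.IH [of l i] less.prems that ortho_poly_norm [of i] in auto)
  have "ip (gs_residual \<rho> j) (ortho_poly \<rho> i) = 
    ip (\<lambda>z. amonom j z - (\<Sum>l<j. ip (amonom j) (ortho_poly \<rho> l) * ortho_poly \<rho> l z)) (ortho_poly \<rho> i)"
    by (simp add: gs_residual_eq [abs_def])
  also have "\<dots> = ip (amonom j) (ortho_poly \<rho> i)
      - (\<Sum>l<j. ip (amonom j) (ortho_poly \<rho> l) * ip (ortho_poly \<rho> l) (ortho_poly \<rho> i))"
    by (simp add: ip_diff ip_sum ip_scale)
  also have "(\<Sum>l<j. ip (amonom j) (ortho_poly \<rho> l) * ip (ortho_poly \<rho> l) (ortho_poly \<rho> i))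
      = (\<Sum>l<j. if l = i then ip (amonom j) (ortho_poly \<rho> i) else 0)"
    using orth by (intro sum.cong) auto
  finally have "ip (gs_residual \<rho> j) (ortho_poly \<rho> i) = 0"
    using less.prems by simp
  then have "ip (\<lambda>z. inverse (complex_of_real (res_norm j)) * gs_residual \<rho> j z) (ortho_poly \<rho> i) = 0"
    by (simp add: ip_scale)
  then show ?case
    by (simp add: ortho_poly_eq [abs_def] divide_inverse mult.commute)
qed

lemma ortho_poly_orthonormal:
  assumes "i < N" "j < N"
  shows "ip (ortho_poly \<rho> i) (ortho_poly \<rho> j) = (if i = j then 1 else 0)"
proof (cases i j rule: linorder_cases)
  case less
  then show ?thesis
    using ortho_poly_orthogonal_less [of i j] assms
      ip_cnj [of "ortho_poly \<rho> j" "ortho_poly \<rho> i"] by simp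
qed (use assms ortho_poly_norm ortho_poly_orthogonal_less in auto)

lemma expands_ortho_poly:
  assumes "i < M" "M \<le> N"
  shows "expands M (ortho_poly \<rho> i)"
  unfolding expands_def
proof
  fix k
  have "(\<Sum>j<M. ip (ortho_poly \<rho> i) (ortho_poly \<rho> j) * ortho_poly \<rho> j (lam k))
      = (\<Sum>j<M. if j = i then ortho_poly \<rho> i (lam k) else 0)"
    using assms by (intro sum.cong) (auto simp: ortho_poly_orthonormal)
  then show "ortho_poly \<rho> i (lam k) =
    (\<Sum>j<M. ip (ortho_poly \<rho> i) (ortho_poly \<rho> j) * ortho_poly \<rho> j (lam k))"
    using assms by simp
qed

lemma expands_mono:
  assumes "expands L f" "L \<le> M" "M \<le> N"
  shows "expands M f"
proof -
  have "expands M (\<lambda>z. \<Sum>j<L. ip f (ortho_poly \<rho> j) * ortho_poly \<rho> j z)"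
    using assms by (intro expands_sum expands_ortho_poly) auto
  then show ?thesis
    by (rule expands_cong) (use assms(1) in \<open>simp add: expands_def\<close>)
qed

lemma expands_amonom:
  assumes "j < M" "M \<le> N"
  shows "expands M (amonom j)"
proof -
  have "expands M (\<lambda>z. complex_of_real (res_norm j) * ortho_poly \<rho> j z +
     (\<Sum>i<j. ip (amonom j) (ortho_poly \<rho> i) * ortho_poly \<rho> i z))"
    using assms by (intro expands_add expands_scale expands_sum expands_ortho_poly) auto
  then show ?thesis
    by (rule expands_cong) (use assms in \<open>simp add: amonom_eq [OF res_pos]\<close>)
qed

text \<open>Induction along \<open>mult_cnj_ortho_poly\<close>: the next monomial reaches index
  \<open>j + 1\<close>, and earlier images reach no further. The bound \<open>j + 2\<close> counts
  the indices from \<open>0\<close> to \<open>j + 1\<close>.\<close>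

lemma expands_mult_cnj_ortho_poly:
  "Suc j < N \<Longrightarrow> expands (j + 2) (\<lambda>z. z * cnj (ortho_poly \<rho> j z))"
proof (induction j rule: less_induct)
  case (less j)
  have "expands (j + 2) (\<lambda>z. z * cnj (ortho_poly \<rho> i z))" if "i < j" for i
    using that less.prems by (intro expands_mono [OF less.IH [OF that]]) auto
  moreover have "expands (j + 2) (amonom (Suc j))"
    using less.prems by (intro expands_amonom) auto
  ultimately show ?case
    by (subst mult_cnj_ortho_poly) (intro expands_scale expands_diff expands_sum; simp)
qed

text \<open>Bessel's inequality for the indicator of each atom, summed over the \<open>n\<close>
  atoms, bounds the sum of the \<open>N\<close> squared norms, each equal to
  \<open>1\<close>.\<close>

lemma bessel: "N \<le> n"
proof -
  have *: "r k * (\<Sum>j<N. (cmod (ortho_poly \<rho> j (lam k)))\<^sup>2) \<le> 1" if k: "k \<in> {1..n}" for k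
  proof -
    define d where "d = point_ind k"
    define c where "c = (\<lambda>j. ip d (ortho_poly \<rho> j))"
    \<comment> \<open>The orthogonal projection of the indicator \<open>d\<close> onto the span of
      the first \<open>N\<close> functions.\<close>
    define s where "s = (\<lambda>z. \<Sum>j<N. c j * ortho_poly \<rho> j z)"
    define S where "S = (\<Sum>j<N. (cmod (ortho_poly \<rho> j (lam k)))\<^sup>2)"
    have d: "ip d f = complex_of_real (r k) * cnj (f (lam k))" for f
      using k by (simp add: d_def ip_point_ind)
    have dd: "ip d d = complex_of_real (r k)"
      by (subst d) (simp add: d_def point_ind_def)
    have sp: "ip s (ortho_poly \<rho> i) = c i" if "i < N" for i
    proof -
      have "ip s (ortho_poly \<rho> i) = (\<Sum>j<N. c j * ip (ortho_poly \<rho> j) (ortho_poly \<rho> i))"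
        by (simp add: s_def ip_sum ip_scale)
      also have "\<dots> = (\<Sum>j<N. if j = i then c i else 0)"
        using that by (intro sum.cong) (auto simp: ortho_poly_orthonormal)
      finally show ?thesis using that by simp
    qed
    have sum_c: "(\<Sum>j<N. c j * cnj (c j)) = complex_of_real ((r k)\<^sup>2 * S)"
      by (simp add: c_def d S_def sum_distrib_left complex_norm_square power2_eq_square [of "r k"]
        mult_ac del: of_real_power)
    have s_left: "ip s g = (\<Sum>j<N. c j * cnj (ip g (ortho_poly \<rho> j)))" for g
      by (simp add: s_def ip_sum ip_scale ip_cnj)
    have ss: "ip s s = (\<Sum>j<N. c j * cnj (c j))"
      using s_left [of s] by (simp add: sp)
    have sd: "ip s d = (\<Sum>j<N. c j * cnj (c j))"
      using s_left [of d] by (simp add: c_def)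
    have ds: "ip d s = (\<Sum>j<N. c j * cnj (c j))"
      using sd ip_cnj [of s d] by (simp add: mult.commute)
    \<comment> \<open>The squared distance from \<open>d\<close> to its projection is nonnegative,
      which is the inequality wanted after division by \<open>r k\<close>.\<close>
    have "ip (\<lambda>z. d z - s z) (\<lambda>z. d z - s z) = ip d d - ip s d - (ip d s - ip s s)"
      by (simp add: ip_def sum_subtractf sum.distrib algebra_simps)
    also have "\<dots> = complex_of_real (r k - (r k)\<^sup>2 * S)"
      by (simp only: dd sum_c ss sd ds) simp
    finally have "0 \<le> r k - (r k)\<^sup>2 * S"
      using ip_self_nonneg [of "\<lambda>z. d z - s z"] by (simp only: Re_complex_of_real)
    then have "r k * (r k * S) \<le> r k * 1" by (simp add: power2_eq_square mult.assoc)
    then show ?thesis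
      using weight_pos [OF k] by (simp add: S_def)
  qed
  have "real N = (\<Sum>j<N. Re (ip (ortho_poly \<rho> j) (ortho_poly \<rho> j)))"
    by (simp add: ortho_poly_norm)
  also have "\<dots> = (\<Sum>k=1..n. r k * (\<Sum>j<N. (cmod (ortho_poly \<rho> j (lam k)))\<^sup>2))"
    by (simp add: ip_self sum_distrib_left) (rule sum.swap)
  also have "\<dots> \<le> (\<Sum>k=1..n. 1)"
    by (intro sum_mono *)
  finally show ?thesis by simp
qed

end

section \<open>Completeness of the Gram--Schmidt functions\<close>

text \<open>Two distinct atoms of equal modulus are nonzero, so their circle is proper and the
  cardinality bound applies. Injectivity carries it over to indices.\<close>

lemma circle_at_most_two:
  assumes "i \<in> {1..n}" "j \<in> {1..n}" "l \<in> {1..n}" "i \<noteq> j"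
    and "cmod (lam i) = cmod (lam j)" "cmod (lam l) = cmod (lam j)"
  shows "l = i \<or> l = j"
proof (rule ccontr)
  assume neg: "\<not> (l = i \<or> l = j)"
  have "lam i \<noteq> lam j" "lam l \<noteq> lam i" "lam l \<noteq> lam j"
    using assms neg inj_lam by (auto dest: inj_onD)
  then have "card {lam i, lam j, lam l} = 3" by auto
  have "0 < cmod (lam j)"
    using \<open>lam i \<noteq> lam j\<close> assms(5) by auto
  then have "card (lam ` {1..n} \<inter> sphere 0 (cmod (lam j))) \<le> 2" by (rule card_circle)
  moreover have "card {lam i, lam j, lam l} \<le> card (lam ` {1..n} \<inter> sphere 0 (cmod (lam j)))"
    using assms by (intro card_mono) auto
  ultimately show False
    using \<open>card {lam i, lam j, lam l} = 3\<close> by simp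
qed

text \<open>Interpolation at the finitely many radii yields all radial functions and their products
  with \<open>z\<close>. As a circle carries at most two atoms, a function affine in
  \<open>z\<close> on that circle singles out one of them.\<close>

lemma expands_of_amonom:
  assumes amonom: "\<And>k. expands N (amonom k)"
  shows "expands N f"
proof -
  have poly: "expands N (\<lambda>z. poly P (complex_of_real ((cmod z)\<^sup>2)))"
    "expands N (\<lambda>z. z * poly P (complex_of_real ((cmod z)\<^sup>2)))" for P
    unfolding mult_poly_square_eq_sum_amonom
    unfolding poly_square_eq_sum_amonom
    by (intro expands_sum amonom)+
  have radial: "expands N (\<lambda>z. a (cmod z))" "expands N (\<lambda>z. z * a (cmod z))"
    for a :: "real \<Rightarrow> complex"
  proof -
    obtain P where P: "\<And>x. x \<in> (\<lambda>k. cmod (lam k)) ` {1..n} \<Longrightarrow> poly P (complex_of_real (x\<^sup>2)) = a x"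
      by (rule poly_interpolation_square [of "(\<lambda>k. cmod (lam k)) ` {1..n}" a]) auto
    show "expands N (\<lambda>z. a (cmod z))"
      by (rule expands_cong [OF poly(1) [of P]]) (subst P, auto)
    show "expands N (\<lambda>z. z * a (cmod z))"
      by (rule expands_cong [OF poly(2) [of P]]) (subst P, auto)
  qed
  have point: "expands N (point_ind k)" if k: "k \<in> {1..n}" for k
  proof -
    \<comment> \<open>Here \<mu> is the other atom on the circle of \<open>lam k\<close>; if there
      is none, any value different from \<open>lam k\<close> will do.\<close>
    have "\<exists>\<mu>. \<mu> \<noteq> lam k \<and>
      (\<forall>i\<in>{1..n}. cmod (lam i) = cmod (lam k) \<longrightarrow> lam i = lam k \<or> lam i = \<mu>)"
    proof (cases "\<exists>i\<in>{1..n}. i \<noteq> k \<and> cmod (lam i) = cmod (lam k)")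
      case True
      then obtain i where i: "i \<in> {1..n}" "i \<noteq> k" "cmod (lam i) = cmod (lam k)" by blast
      then have "lam i \<noteq> lam k" using k inj_lam by (auto dest: inj_onD)
      moreover have "\<forall>l\<in>{1..n}. cmod (lam l) = cmod (lam k) \<longrightarrow> lam l = lam k \<or> lam l = lam i"
        using circle_at_most_two [OF i(1) k _ i(2,3)] by blast
      ultimately show ?thesis by blast
    next
      case False
      then show ?thesis by (intro exI [of _ "lam k + 1"]) auto
    qed
    then obtain \<mu> where \<mu>: "\<mu> \<noteq> lam k"
      "\<And>i. i \<in> {1..n} \<Longrightarrow> cmod (lam i) = cmod (lam k) \<Longrightarrow> lam i = lam k \<or> lam i = \<mu>"
      by blast
    define a :: "real \<Rightarrow> complex" where "a = (\<lambda>x. if x = cmod (lam k) then 1 else 0)"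
    \<comment> \<open>On the circle this is \<open>(z - \<mu>) / (lam k - \<mu>)\<close>, off it
      \<open>0\<close>; so it is the point indicator on the atoms.\<close>
    have "expands N (\<lambda>z. inverse (lam k - \<mu>) * (z * a (cmod z) - \<mu> * a (cmod z)))"
      by (intro expands_scale expands_diff radial)
    then show ?thesis
    proof (rule expands_cong)
      fix i assume i: "i \<in> {1..n}"
      show "point_ind k (lam i) =
        inverse (lam k - \<mu>) * (lam i * a (cmod (lam i)) - \<mu> * a (cmod (lam i)))"
        using \<mu>(1) \<mu>(2) [OF i] by (auto simp: a_def point_ind_def)
    qed
  qed
  have "expands N (\<lambda>z. \<Sum>k=1..n. f (lam k) * point_ind k z)"
    by (intro expands_sum point) auto
  then show ?thesis
    by (rule expands_cong) (rule sum_point_ind [symmetric])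
qed

text \<open>
  Let \<open>N\<close> be the first index at which the Gram--Schmidt residual vanishes.  The span of the first
  \<open>N\<close> orthonormal functions is invariant under \<open>f \<mapsto> z * cnj f\<close>, so it contains all monomials and
  with them every function on the atoms.  Expanding the point indicators and taking the trace
  gives \<open>N = n\<close>; this replaces a proof of linear independence of the monomials.
\<close>

lemma ortho_basis: "(\<forall>j<n. 0 < res_norm j) \<and> (\<forall>f. expands n f)"
proof -
  \<comment> \<open>Otherwise \<open>Suc n\<close> functions would be orthonormal, against the bound
    from \<open>bessel\<close>.\<close>
  have "\<exists>N. res_norm N = 0"
  proof (rule ccontr)
    assume "\<nexists>N. res_norm N = 0"
    then have "0 < res_norm j" for j
      using res_norm_nonneg [of j] by (metis less_le)
    then have "Suc n \<le> n" by (intro bessel)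
    then show False by simp
  qed
  define N where "N = (LEAST N. res_norm N = 0)"
  have N: "res_norm N = 0"
    unfolding N_def by (rule LeastI_ex) fact
  have pos: "0 < res_norm j" if "j < N" for j
    using that not_less_Least [of j "\<lambda>N. res_norm N = 0"] res_norm_nonneg [of j]
    by (simp add: less_le N_def)
  have "0 < N" using N res_norm_0 by (cases N) auto
  have amonom_N: "expands N (amonom N)"
  proof -
    have "expands N (\<lambda>z. \<Sum>i<N. ip (amonom N) (ortho_poly \<rho> i) * ortho_poly \<rho> i z)"
      using pos by (intro expands_sum expands_ortho_poly [of N]) auto
    moreover have "gs_residual \<rho> N (lam k) = 0" if "k \<in> {1..n}" for k
      using N that by (intro ip_self_eq_0) (simp_all add: res_norm_def)
    ultimately show ?thesis
      by (elim expands_cong) (simp add: gs_residual_eq)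
  qed
  have mult_cnj_p: "expands N (\<lambda>z. z * cnj (ortho_poly \<rho> j z))" if j: "j < N" for j
  proof (cases "Suc j < N")
    case True
    then show ?thesis
      using pos by (intro expands_mono [OF _ expands_mult_cnj_ortho_poly [OF _ True], of N]) auto
  next
    \<comment> \<open>At the last index the next monomial is \<open>amonom N\<close>, whose
      expansion is due to the vanishing residual.\<close>
    case False
    then have "Suc j = N" using j by simp
    have "expands N (\<lambda>z. z * cnj (ortho_poly \<rho> i z))" if "i < j" for i
      using pos that j
      by (intro expands_mono [OF _ expands_mult_cnj_ortho_poly [of N], of N]) auto
    then show ?thesis
      using amonom_N \<open>Suc j = N\<close>
      by (subst mult_cnj_ortho_poly) (intro expands_scale expands_diff expands_sum; simp)
  qed
  have mult_cnj: "expands N (\<lambda>z. z * cnj (f z))" if f: "expands N f" for f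
  proof -
    have "expands N (\<lambda>z. \<Sum>j<N. cnj (ip f (ortho_poly \<rho> j)) * (z * cnj (ortho_poly \<rho> j z)))"
      by (intro expands_sum mult_cnj_p) auto
    then show ?thesis
    proof (rule expands_cong)
      fix k assume "k \<in> {1..n}"
      then have "f (lam k) = (\<Sum>j<N. ip f (ortho_poly \<rho> j) * ortho_poly \<rho> j (lam k))"
        using f by (simp add: expands_def)
      then show "lam k * cnj (f (lam k)) =
        (\<Sum>j<N. cnj (ip f (ortho_poly \<rho> j)) * (lam k * cnj (ortho_poly \<rho> j (lam k))))"
        by (simp only: cnj_sum complex_cnj_mult sum_distrib_left mult.left_commute)
    qed
  qed
  have "expands N (amonom k)" for k
  proof (induction k)
    case 0
    then show ?case using pos \<open>0 < N\<close> by (intro expands_amonom [of N]) auto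
  next
    case (Suc k)
    then show ?case using mult_cnj [OF Suc] by (simp add: mult_cnj_amonom)
  qed
  then have all: "expands N f" for f by (rule expands_of_amonom)
  have "(\<Sum>j<N. ip (ortho_poly \<rho> j) (ortho_poly \<rho> j)) =
    (\<Sum>k=1..n. \<Sum>j<N. ip (point_ind k) (ortho_poly \<rho> j) * ortho_poly \<rho> j (lam k))"
    by (subst sum.swap, intro sum.cong refl)
      (subst ip_def, intro sum.cong refl, simp only: ip_point_ind mult_ac)
  also have "\<dots> = (\<Sum>k=1..n. point_ind k (lam k))"
    using all by (intro sum.cong) (auto simp: expands_def)
  also have "\<dots> = of_nat n" by (simp add: point_ind_def)
  also have "(\<Sum>j<N. ip (ortho_poly \<rho> j) (ortho_poly \<rho> j)) = of_nat N"
    by (simp add: ortho_poly_norm [OF pos])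
  finally have "N = n" by (simp only: of_nat_eq_iff)
  with pos all show ?thesis by blast
qed

section \<open>The Jacobi matrix\<close>

text \<open>The image of the function with index \<open>i\<close> lies in the span of the first
  \<open>i + 2\<close> functions, all orthogonal to the one with index \<open>j\<close>.\<close>

lemma ip_mult_cnj_ortho_poly_less:
  assumes "Suc i < j" "j < n"
  shows "ip (\<lambda>z. z * cnj (ortho_poly \<rho> i z)) (ortho_poly \<rho> j) = 0"
proof -
  let ?h = "\<lambda>z. z * cnj (ortho_poly \<rho> i z)"
  have pos: "\<And>l. l < n \<Longrightarrow> 0 < res_norm l" using ortho_basis by blast
  have "expands (i + 2) ?h"
    using assms by (intro expands_mult_cnj_ortho_poly [OF pos]) auto
  then have "ip ?h (ortho_poly \<rho> j) =
    ip (\<lambda>z. \<Sum>l<i + 2. ip ?h (ortho_poly \<rho> l) * ortho_poly \<rho> l z) (ortho_poly \<rho> j)"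
    by (intro ip_cong) (auto simp: expands_def)
  also have "\<dots> = (\<Sum>l<i + 2. ip ?h (ortho_poly \<rho> l) * ip (ortho_poly \<rho> l) (ortho_poly \<rho> j))"
    by (simp only: ip_sum ip_scale)
  also have "\<dots> = 0"
    using assms by (intro sum.neutral) (auto simp: ortho_poly_orthonormal [OF pos])
  finally show ?thesis .
qed

text \<open>Symmetry supplies the entries with \<open>j < i\<close>, without conjugation. Parameters
  are indexed from \<open>1\<close> and functions from \<open>0\<close>, whence the
  \<open>Suc\<close>.\<close>

lemma ip_mult_cnj_ortho_poly:
  assumes "i < n" "j < n"
  shows "ip (\<lambda>z. z * cnj (ortho_poly \<rho> i z)) (ortho_poly \<rho> j) =
    (if j = i then jacobi_alpha \<rho> (Suc i)
     else if j = Suc i then jacobi_beta \<rho> (Suc i)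
     else if i = Suc j then jacobi_beta \<rho> (Suc j) else 0)"
proof -
  have meas: "(\<lambda>z. z * cnj (ortho_poly \<rho> l z)) \<in> borel_measurable borel" for l
    by (intro borel_measurable_times measurable_compose [OF ortho_poly_measurable])
      (auto intro!: borel_measurable_continuous_onI continuous_intros)
  have alpha: "jacobi_alpha \<rho> (Suc l) = ip (\<lambda>z. z * cnj (ortho_poly \<rho> l z)) (ortho_poly \<rho> l)" for l
    by (simp add: jacobi_alpha_def inner_L2_eq_ip meas)
  have beta: "jacobi_beta \<rho> (Suc l) = ip (\<lambda>z. z * cnj (ortho_poly \<rho> l z)) (ortho_poly \<rho> (Suc l))" for l
    by (simp add: jacobi_beta_def inner_L2_eq_ip meas)
  consider "j = i" | "j = Suc i" | "i = Suc j" | "Suc i < j" | "Suc j < i" by linarith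
  then show ?thesis
  proof cases
    case 3
    then show ?thesis
      using ip_mult_cnj_sym [of "ortho_poly \<rho> i" "ortho_poly \<rho> j"] by (simp add: beta)
  next
    case 5
    then show ?thesis
      using ip_mult_cnj_sym [of "ortho_poly \<rho> i" "ortho_poly \<rho> j"] assms
      by (simp add: ip_mult_cnj_ortho_poly_less)
  qed (use assms in \<open>simp_all add: alpha beta ip_mult_cnj_ortho_poly_less\<close>)
qed

text \<open>Completeness expands \<open>f\<close>, and antilinearity conjugates the coefficients. So
  the matrix alone takes the coefficients of \<open>f\<close> to those of its image.\<close>

lemma ip_mult_cnj_expand:
  "ip (\<lambda>z. z * cnj (f z)) g =
    (\<Sum>i<n. cnj (ip f (ortho_poly \<rho> i)) * ip (\<lambda>z. z * cnj (ortho_poly \<rho> i z)) g)"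
proof -
  have "ip (\<lambda>z. z * cnj (f z)) g =
    ip (\<lambda>z. \<Sum>i<n. cnj (ip f (ortho_poly \<rho> i)) * (z * cnj (ortho_poly \<rho> i z))) g"
  proof (rule ip_cong)
    fix k assume "k \<in> {1..n}"
    then have "f (lam k) = (\<Sum>j<n. ip f (ortho_poly \<rho> j) * ortho_poly \<rho> j (lam k))"
      using ortho_basis by (auto simp: expands_def)
    then show "lam k * cnj (f (lam k)) =
      (\<Sum>j<n. cnj (ip f (ortho_poly \<rho> j)) * (lam k * cnj (ortho_poly \<rho> j (lam k))))"
      by (simp only: cnj_sum complex_cnj_mult sum_distrib_left mult.left_commute)
  qed simp
  then show ?thesis by (simp only: ip_sum ip_scale)
qed

lemma n_pos: "0 < n"
  using weight_sum by (cases n) auto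

end

section \<open>Jacobi parameters and radial integrals of two measures\<close>

locale biradial_pair = biradial n r lam \<rho> + B: biradial n r' lam' \<rho>'
  for n r lam \<rho> r' lam' \<rho>'
begin

text \<open>The inner product with the constant \<open>1\<close> is the plain integral. Arbitrary
  \<open>a\<close> is harmless, as finitely many radii matter.\<close>

definition same_radial_integrals :: bool where
  "same_radial_integrals \<longleftrightarrow> (\<forall>a :: real \<Rightarrow> complex.
     ip (\<lambda>z. a (cmod z)) (\<lambda>_. 1) = B.ip (\<lambda>z. a (cmod z)) (\<lambda>_. 1) \<and>
     ip (\<lambda>z. z * a (cmod z)) (\<lambda>_. 1) = B.ip (\<lambda>z. z * a (cmod z)) (\<lambda>_. 1))"

definition same_jacobi :: bool where
  "same_jacobi \<longleftrightarrow>
     (\<forall>j\<in>{1..n}. jacobi_alpha \<rho> j = jacobi_alpha \<rho>' j) \<and>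
     (\<forall>j\<in>{1..n - 1}. jacobi_beta \<rho> j = jacobi_beta \<rho>' j)"

lemma same_jacobi_imp_moments:
  assumes "same_jacobi"
  shows "ip (amonom k) (\<lambda>_. 1) = B.ip (amonom k) (\<lambda>_. 1)"
proof -
  have jac: "ip (\<lambda>z. z * cnj (ortho_poly \<rho> i z)) (ortho_poly \<rho> j) =
      B.ip (\<lambda>z. z * cnj (ortho_poly \<rho>' i z)) (ortho_poly \<rho>' j)" if "i < n" "j < n" for i j
    using that assms unfolding ip_mult_cnj_ortho_poly [OF that] B.ip_mult_cnj_ortho_poly [OF that]
    by (auto simp: same_jacobi_def)
  \<comment> \<open>The induction needs all coefficients of the monomial in the two bases; the
    moment is the one at index \<open>0\<close>, where both functions are \<open>1\<close>.\<close>
  have "ip (amonom k) (ortho_poly \<rho> j) = B.ip (amonom k) (ortho_poly \<rho>' j)" if "j < n" for j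
    using that
  proof (induction k arbitrary: j)
    case 0
    have "ip (amonom 0) (ortho_poly \<rho> j) = ip (ortho_poly \<rho> 0) (ortho_poly \<rho> j)"
      "B.ip (amonom 0) (ortho_poly \<rho>' j) = B.ip (ortho_poly \<rho>' 0) (ortho_poly \<rho>' j)"
      by (simp_all add: ortho_poly_0 B.ortho_poly_0 ip_def B.ip_def)
    then show ?case
      using ortho_basis B.ortho_basis 0 n_pos
      by (simp only: ortho_poly_orthonormal [of n] B.ortho_poly_orthonormal [of n])
  next
    case (Suc k)
    have "ip (\<lambda>z. z * cnj (amonom k z)) (ortho_poly \<rho> j) =
      B.ip (\<lambda>z. z * cnj (amonom k z)) (ortho_poly \<rho>' j)"
      unfolding ip_mult_cnj_expand [of "amonom k"] B.ip_mult_cnj_expand [of "amonom k"]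
      using Suc by (intro sum.cong) (auto simp: jac)
    then show ?case by (simp add: mult_cnj_amonom)
  qed
  from this [OF n_pos] show ?thesis by (simp add: ortho_poly_0 B.ortho_poly_0)
qed

lemma moments_imp_same_radial_integrals:
  assumes "\<And>k. ip (amonom k) (\<lambda>_. 1) = B.ip (amonom k) (\<lambda>_. 1)"
  shows "same_radial_integrals"
  unfolding same_radial_integrals_def
proof (intro allI)
  fix a :: "real \<Rightarrow> complex"
  \<comment> \<open>The nodes include the radii of both measures, so that one polynomial replaces
    \<open>a\<close> in both integrals.\<close>
  let ?X = "(\<lambda>k. cmod (lam k)) ` {1..n} \<union> (\<lambda>k. cmod (lam' k)) ` {1..n}"
  obtain P where P: "\<And>x. x \<in> ?X \<Longrightarrow> poly P (complex_of_real (x\<^sup>2)) = a x"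
    by (rule poly_interpolation_square [of ?X a]) auto
  have "ip (\<lambda>z. a (cmod z)) (\<lambda>_. 1) = (\<Sum>i\<le>degree P. coeff P i * ip (amonom (2 * i)) (\<lambda>_. 1))"
    unfolding ip_scale [symmetric] ip_sum [symmetric] poly_square_eq_sum_amonom [symmetric]
    by (intro ip_cong) (subst P, auto)
  moreover have "B.ip (\<lambda>z. a (cmod z)) (\<lambda>_. 1) = (\<Sum>i\<le>degree P. coeff P i * B.ip (amonom (2 * i)) (\<lambda>_. 1))"
    unfolding B.ip_scale [symmetric] B.ip_sum [symmetric] poly_square_eq_sum_amonom [symmetric]
    by (intro B.ip_cong) (subst P, auto)
  moreover have "ip (\<lambda>z. z * a (cmod z)) (\<lambda>_. 1) =
      (\<Sum>i\<le>degree P. coeff P i * ip (amonom (Suc (2 * i))) (\<lambda>_. 1))"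
    unfolding ip_scale [symmetric] ip_sum [symmetric]
      mult_poly_square_eq_sum_amonom [symmetric]
    by (intro ip_cong) (subst P, auto)
  moreover have "B.ip (\<lambda>z. z * a (cmod z)) (\<lambda>_. 1) =
      (\<Sum>i\<le>degree P. coeff P i * B.ip (amonom (Suc (2 * i))) (\<lambda>_. 1))"
    unfolding B.ip_scale [symmetric] B.ip_sum [symmetric]
      mult_poly_square_eq_sum_amonom [symmetric]
    by (intro B.ip_cong) (subst P, auto)
  ultimately show "ip (\<lambda>z. a (cmod z)) (\<lambda>_. 1) = B.ip (\<lambda>z. a (cmod z)) (\<lambda>_. 1) \<and>
     ip (\<lambda>z. z * a (cmod z)) (\<lambda>_. 1) = B.ip (\<lambda>z. z * a (cmod z)) (\<lambda>_. 1)"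
    using assms by simp
qed

text \<open>Of the four terms of \<open>f z * cnj (g z)\<close>, two are radial because
  \<open>z * cnj z\<close> is, one is \<open>z\<close> times a radial function, and one is the
  conjugate of such a product.\<close>

lemma same_radial_integrals_imp_inner_eq:
  assumes same: "same_radial_integrals" and "radial_affine f" "radial_affine g"
  shows "inner_L2 \<rho> f g = inner_L2 \<rho>' f g"
proof -
  obtain a b where f: "f \<in> borel_measurable borel" "\<And>z. f z = a (cmod z) + z * b (cmod z)"
    using assms by (auto simp: radial_affine_def)
  obtain c d where g: "g \<in> borel_measurable borel" "\<And>z. g z = c (cmod z) + z * d (cmod z)"
    using assms by (auto simp: radial_affine_def)
  define A where "A = (\<lambda>x. a x * cnj (c x) + complex_of_real (x\<^sup>2) * (b x * cnj (d x)))"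
  have fg: "f z * cnj (g z) = A (cmod z) + z * (b (cmod z) * cnj (c (cmod z)))
      + cnj (z * (cnj (a (cmod z)) * d (cmod z)))" for z
    unfolding A_def f(2) g(2) complex_norm_square by (simp add: algebra_simps)
  have "ip f g = ip (\<lambda>z. A (cmod z)) (\<lambda>_. 1) + ip (\<lambda>z. z * (b (cmod z) * cnj (c (cmod z)))) (\<lambda>_. 1)
      + cnj (ip (\<lambda>z. z * (cnj (a (cmod z)) * d (cmod z))) (\<lambda>_. 1))"
    unfolding ip_def fg by (simp add: distrib_left sum.distrib)
  moreover have "B.ip f g = B.ip (\<lambda>z. A (cmod z)) (\<lambda>_. 1) + B.ip (\<lambda>z. z * (b (cmod z) * cnj (c (cmod z)))) (\<lambda>_. 1)
      + cnj (B.ip (\<lambda>z. z * (cnj (a (cmod z)) * d (cmod z))) (\<lambda>_. 1))"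
    unfolding B.ip_def fg by (simp add: distrib_left sum.distrib)
  moreover have "ip (\<lambda>z. A (cmod z)) (\<lambda>_. 1) = B.ip (\<lambda>z. A (cmod z)) (\<lambda>_. 1)"
    "ip (\<lambda>z. z * h (cmod z)) (\<lambda>_. 1) = B.ip (\<lambda>z. z * h (cmod z)) (\<lambda>_. 1)" for h :: "real \<Rightarrow> complex"
    using same by (auto simp: same_radial_integrals_def)
  note this(1) this(2) [of "\<lambda>x. b x * cnj (c x)"] this(2) [of "\<lambda>x. cnj (a x) * d x"]
  ultimately show ?thesis
    using f(1) g(1) by (simp add: inner_L2_eq_ip B.inner_L2_eq_ip)
qed

text \<open>Gram--Schmidt only takes inner products of radially affine functions, so by induction it
  yields identical functions on the whole plane for both measures.\<close>

lemma same_radial_integrals_imp_same_jacobi: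
  assumes "same_radial_integrals"
  shows "same_jacobi"
proof -
  note inner = same_radial_integrals_imp_inner_eq [OF assms]
  have p: "ortho_poly \<rho> j = ortho_poly \<rho>' j" for j
  proof (induction j rule: less_induct)
    case (less j)
    have "gs_residual \<rho> j z = gs_residual \<rho>' j z" for z
      unfolding gs_residual_def inner [OF radial_affine_amonom radial_affine_ortho_poly]
      using less by simp
    then have "gs_residual \<rho> j = gs_residual \<rho>' j" ..
    with inner [OF radial_affine_residual radial_affine_residual, of \<rho> j \<rho> j]
    show ?case by (intro ext) (simp add: ortho_poly_eq_residual [of _ j])
  qed
  show ?thesis
    unfolding same_jacobi_def jacobi_alpha_def jacobi_beta_def
    by (auto simp: p [symmetric] inner radial_affine_mult_cnj radial_affine_ortho_poly)
qed

lemma same_jacobi_iff: "same_jacobi \<longleftrightarrow> same_radial_integrals"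
  using same_jacobi_imp_moments moments_imp_same_radial_integrals
    same_radial_integrals_imp_same_jacobi by blast

end

section \<open>Sums over pairs, and strict convexity of the disc\<close>

lemma sum_split_pairs:
  fixes f :: "nat \<Rightarrow> 'a::comm_monoid_add"
  assumes "2 * m \<le> n"
  shows "(\<Sum>i=1..n. f i) = (\<Sum>k=1..m. f (2 * k - 1) + f (2 * k)) + (\<Sum>i=2 * m + 1..n. f i)"
proof -
  have "(\<Sum>i=1..2 * m. f i) = (\<Sum>k=1..m. f (2 * k - 1) + f (2 * k))"
    by (induction m) (simp_all add: algebra_simps)
  moreover have "{1..n} = {1..2 * m} \<union> {2 * m + 1..n}" using assms by auto
  ultimately show ?thesis by (simp add: sum.union_disjoint)
qed

lemma strict_mono_on_Suc:
  fixes f :: "nat \<Rightarrow> 'a::order"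
  assumes "\<And>k. a \<le> k \<Longrightarrow> k < b \<Longrightarrow> f k < f (Suc k)"
  shows "strict_mono_on {a..b} f"
proof (rule strict_mono_onI)
  fix i j assume "i \<in> {a..b}" "j \<in> {a..b}" "i < j"
  from \<open>i < j\<close> \<open>j \<in> {a..b}\<close> show "f i < f j"
  proof (induction j)
    case (Suc j)
    have "f j < f (Suc j)" using Suc.prems \<open>i \<in> {a..b}\<close> by (intro assms) auto
    moreover have "f i \<le> f j"
      using Suc \<open>i \<in> {a..b}\<close> by (cases "i = j") (auto simp: less_imp_le)
    ultimately show ?case by simp
  qed simp
qed

text \<open>Equality in the triangle inequality would give both summands the same direction, hence
  \<open>z = w\<close> as the moduli agree and are nonzero.\<close>

lemma cmod_weighted_sum_less:
  assumes "0 < s" "0 < t" "cmod z = R" "cmod w = R" "z \<noteq> w"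
  shows "cmod (complex_of_real s * z + complex_of_real t * w) < R * (s + t)"
proof -
  have "R \<noteq> 0" using assms by auto
  have "cmod (complex_of_real s * z + complex_of_real t * w) \<noteq>
      cmod (complex_of_real s * z) + cmod (complex_of_real t * w)"
  proof
    assume "cmod (complex_of_real s * z + complex_of_real t * w) =
      cmod (complex_of_real s * z) + cmod (complex_of_real t * w)"
    then have "(s * R) *\<^sub>R (complex_of_real t * w) = (t * R) *\<^sub>R (complex_of_real s * z)"
      using assms unfolding norm_triangle_eq by (simp add: norm_mult)
    then have "complex_of_real (s * t * R) * w = complex_of_real (s * t * R) * z"
      by (simp add: scaleR_conv_of_real mult_ac)
    then show False using assms \<open>R \<noteq> 0\<close> by simp
  qed
  moreover have "cmod (complex_of_real s * z) + cmod (complex_of_real t * w) = R * (s + t)"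
    using assms by (simp add: norm_mult algebra_simps)
  ultimately show ?thesis
    using norm_triangle_ineq [of "complex_of_real s * z" "complex_of_real t * w"] by simp
qed

section \<open>Mass and first moment on a circle\<close>

context biradial
begin

text \<open>Indexed by an arbitrary real radius, with empty value where no atom lies, so that two
  measures can be compared before their indices are matched.\<close>

definition circ :: "real \<Rightarrow> nat set" where
  "circ R = {i \<in> {1..n}. cmod (lam i) = R}"

definition mass :: "real \<Rightarrow> real" where
  "mass R = (\<Sum>i\<in>circ R. r i)"

definition moment :: "real \<Rightarrow> complex" where
  "moment R = (\<Sum>i\<in>circ R. complex_of_real (r i) * lam i)"

lemma mass_eq_ip:
  "complex_of_real (mass R) = ip (\<lambda>z. if cmod z = R then 1 else 0) (\<lambda>_. 1)"
  unfolding mass_def circ_def ip_def of_real_sum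
  by (subst sum.inter_filter) (auto intro!: sum.cong)

lemma moment_eq_ip:
  "moment R = ip (\<lambda>z. z * (if cmod z = R then 1 else 0)) (\<lambda>_. 1)"
  unfolding moment_def circ_def ip_def
  by (subst sum.inter_filter) (auto intro!: sum.cong)

context
  fixes m :: nat
  assumes ordered: "modulus_ordered n m lam"
begin

lemma two_m_le: "2 * m \<le> n"
  using ordered by (simp add: modulus_ordered_def)

lemma pair_modulus: "k \<in> {1..m} \<Longrightarrow> cmod (lam (2 * k - 1)) = cmod (lam (2 * k))"
  using ordered by (simp add: modulus_ordered_def)

lemma circ_pair:
  assumes "k \<in> {1..m}"
  shows "circ (cmod (lam (2 * k))) = {2 * k - 1, 2 * k}"
proof -
  have k: "2 * k - 1 \<in> {1..n}" "2 * k \<in> {1..n}" "2 * k - 1 \<noteq> 2 * k"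
    using assms two_m_le by auto
  show ?thesis
    using circle_at_most_two [OF k(1,2) _ k(3) pair_modulus [OF assms]] k pair_modulus [OF assms]
    by (auto simp: circ_def)
qed

lemma strict_mono_pairs: "strict_mono_on {1..m} (\<lambda>k. cmod (lam (2 * k)))"
proof (rule strict_mono_on_Suc)
  fix k assume k: "1 \<le> k" "k < m"
  then have "cmod (lam (2 * k - 1)) < cmod (lam (2 * k + 1))"
    using ordered unfolding modulus_ordered_def by blast
  \<comment> \<open>The ordering is given for the odd members; equality within each pair carries it
    to the even ones.\<close>
  then show "cmod (lam (2 * k)) < cmod (lam (2 * Suc k))"
    using k pair_modulus [of k] pair_modulus [of "k + 1"] by simp
qed

lemma strict_mono_singles: "strict_mono_on {2 * m + 1..n} (\<lambda>k. cmod (lam k))"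
  using ordered by (intro strict_mono_on_Suc) (auto simp: modulus_ordered_def)

lemma index_cases:
  assumes "i \<in> {1..n}"
  obtains (pair) k where "k \<in> {1..m}" "i = 2 * k - 1 \<or> i = 2 * k"
    | (single) "i \<in> {2 * m + 1..n}"
proof (cases "i \<le> 2 * m")
  case True
  then show thesis
    \<comment> \<open>The number of the pair containing \<open>i\<close>, for odd and even
      \<open>i\<close> alike.\<close>
    using assms by (intro pair [of "(i + 1) div 2"]) auto
qed (use assms single in auto)

text \<open>The circle of a pair is already full, and the moduli of single points are distinct. The
  first point matters because the ordering does not compare pairs with single points.\<close>

lemma circ_single:
  assumes "k \<in> {2 * m + 1..n}"
  shows "circ (cmod (lam k)) = {k}"
proof -
  have "i = k" if i: "i \<in> {1..n}" "cmod (lam i) = cmod (lam k)" for i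
    using i(1)
  proof (cases rule: index_cases)
    case (pair l)
    then have "k \<in> circ (cmod (lam (2 * l)))"
      using i assms pair_modulus [of l] by (auto simp: circ_def)
    then show ?thesis using circ_pair [of l] pair assms by auto
  next
    case single
    then show ?thesis
      using i assms strict_mono_on_imp_inj_on [OF strict_mono_singles] by (auto dest: inj_onD)
  qed
  then show ?thesis using assms by (auto simp: circ_def)
qed

lemma mass_pair: "k \<in> {1..m} \<Longrightarrow> mass (cmod (lam (2 * k))) = r (2 * k - 1) + r (2 * k)"
  by (subst mass_def, subst circ_pair, assumption, subst sum.insert) auto

lemma moment_pair:
  "k \<in> {1..m} \<Longrightarrow> moment (cmod (lam (2 * k))) =
     complex_of_real (r (2 * k - 1)) * lam (2 * k - 1) + complex_of_real (r (2 * k)) * lam (2 * k)"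
  by (subst moment_def, subst circ_pair, assumption, subst sum.insert) auto

lemma mass_single: "k \<in> {2 * m + 1..n} \<Longrightarrow> mass (cmod (lam k)) = r k"
  by (simp add: mass_def circ_single)

lemma moment_single:
  "k \<in> {2 * m + 1..n} \<Longrightarrow> moment (cmod (lam k)) = complex_of_real (r k) * lam k"
  by (simp add: moment_def circ_single)

lemma moment_less_pair:
  assumes "k \<in> {1..m}" "R = cmod (lam (2 * k))"
  shows "cmod (moment R) < R * mass R"
proof -
  have k: "2 * k - 1 \<in> {1..n}" "2 * k \<in> {1..n}" "2 * k - 1 \<noteq> 2 * k"
    using assms two_m_le by auto
  then have "lam (2 * k - 1) \<noteq> lam (2 * k)"
    using inj_lam by (auto dest: inj_onD)
  then show ?thesis
    unfolding assms(2) mass_pair [OF assms(1)] moment_pair [OF assms(1)]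
    using k weight_pos pair_modulus [OF assms(1)] by (intro cmod_weighted_sum_less) auto
qed

lemma moment_eq_single:
  assumes "k \<in> {2 * m + 1..n}" "R = cmod (lam k)"
  shows "cmod (moment R) = R * mass R" "0 < mass R"
  using assms weight_pos [of k] by (auto simp: mass_single moment_single norm_mult)

lemma radius_cases:
  obtains (pair) k where "k \<in> {1..m}" "R = cmod (lam (2 * k))"
    | (single) k where "k \<in> {2 * m + 1..n}" "R = cmod (lam k)"
    | (none) "mass R = 0" "moment R = 0"
proof (cases "circ R = {}")
  case False
  then obtain i where "i \<in> {1..n}" "cmod (lam i) = R" by (auto simp: circ_def)
  then show thesis
    using pair single pair_modulus by (cases rule: index_cases) auto
qed (use none in \<open>simp add: mass_def moment_def\<close>)

text \<open>A circle with one atom gives equality, an empty one \<open>0 < 0\<close>. The right-hand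
  side no longer mentions indices or \<open>m\<close>, so mass and moment determine the radii of the
  pairs.\<close>

lemma pair_radii: "(\<lambda>k. cmod (lam (2 * k))) ` {1..m} = {R. cmod (moment R) < R * mass R}"
proof (intro equalityI subsetI)
  fix R assume "R \<in> {R. cmod (moment R) < R * mass R}"
  then show "R \<in> (\<lambda>k. cmod (lam (2 * k))) ` {1..m}"
    by (cases R rule: radius_cases) (use moment_eq_single(1) in fastforce)+
qed (auto intro: moment_less_pair)

text \<open>The condition \<open>mass R \<noteq> 0\<close> excludes circles without atoms, which
  also fail the strict inequality.\<close>

lemma single_radii:
  "(\<lambda>k. cmod (lam k)) ` {2 * m + 1..n} = {R. mass R \<noteq> 0 \<and> \<not> cmod (moment R) < R * mass R}"
proof (intro equalityI subsetI)
  fix R assume "R \<in> {R. mass R \<noteq> 0 \<and> \<not> cmod (moment R) < R * mass R}"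
  then show "R \<in> (\<lambda>k. cmod (lam k)) ` {2 * m + 1..n}"
    by (cases R rule: radius_cases) (use moment_less_pair in fastforce)+
next
  fix R assume "R \<in> (\<lambda>k. cmod (lam k)) ` {2 * m + 1..n}"
  then obtain k where "k \<in> {2 * m + 1..n}" "R = cmod (lam k)" by blast
  from moment_eq_single [OF this] show "R \<in> {R. mass R \<noteq> 0 \<and> \<not> cmod (moment R) < R * mass R}"
    by simp
qed

lemma card_pair_radii: "card {R. cmod (moment R) < R * mass R} = m"
  unfolding pair_radii [symmetric]
  by (subst card_image [OF strict_mono_on_imp_inj_on [OF strict_mono_pairs]]) simp

text \<open>Grouping by circles leaves only pair masses, pair radii and the data of single points;
  this and its analogue with the factor \<open>z\<close> give the converse direction.\<close>

lemma ip_radial_split: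
  "ip (\<lambda>z. a (cmod z)) (\<lambda>_. 1) =
     (\<Sum>k=1..m. complex_of_real (r (2 * k - 1) + r (2 * k)) * a (cmod (lam (2 * k)))) +
     (\<Sum>k=2 * m + 1..n. complex_of_real (r k) * a (cmod (lam k)))"
proof -
  have "ip (\<lambda>z. a (cmod z)) (\<lambda>_. 1) = (\<Sum>k=1..n. complex_of_real (r k) * a (cmod (lam k)))"
    by (simp add: ip_def)
  also have "\<dots> = (\<Sum>k=1..m. complex_of_real (r (2 * k - 1)) * a (cmod (lam (2 * k - 1)))
        + complex_of_real (r (2 * k)) * a (cmod (lam (2 * k)))) +
     (\<Sum>k=2 * m + 1..n. complex_of_real (r k) * a (cmod (lam k)))"
    by (rule sum_split_pairs [OF two_m_le])
  also have "(\<Sum>k=1..m. complex_of_real (r (2 * k - 1)) * a (cmod (lam (2 * k - 1)))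
        + complex_of_real (r (2 * k)) * a (cmod (lam (2 * k)))) =
      (\<Sum>k=1..m. complex_of_real (r (2 * k - 1) + r (2 * k)) * a (cmod (lam (2 * k))))"
    by (intro sum.cong refl) (simp only: pair_modulus distrib_right of_real_add)
  finally show ?thesis .
qed

lemma ip_mult_radial_split:
  "ip (\<lambda>z. z * a (cmod z)) (\<lambda>_. 1) =
     (\<Sum>k=1..m. (complex_of_real (r (2 * k - 1)) * lam (2 * k - 1) +
        complex_of_real (r (2 * k)) * lam (2 * k)) * a (cmod (lam (2 * k)))) +
     (\<Sum>k=2 * m + 1..n. complex_of_real (r k) * lam k * a (cmod (lam k)))"
proof -
  have "ip (\<lambda>z. z * a (cmod z)) (\<lambda>_. 1) = (\<Sum>k=1..n. complex_of_real (r k) * lam k * a (cmod (lam k)))"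
    by (simp add: ip_def mult.assoc)
  also have "\<dots> = (\<Sum>k=1..m. complex_of_real (r (2 * k - 1)) * lam (2 * k - 1) * a (cmod (lam (2 * k - 1)))
        + complex_of_real (r (2 * k)) * lam (2 * k) * a (cmod (lam (2 * k)))) +
     (\<Sum>k=2 * m + 1..n. complex_of_real (r k) * lam k * a (cmod (lam k)))"
    by (rule sum_split_pairs [OF two_m_le])
  also have "(\<Sum>k=1..m. complex_of_real (r (2 * k - 1)) * lam (2 * k - 1) * a (cmod (lam (2 * k - 1)))
        + complex_of_real (r (2 * k)) * lam (2 * k) * a (cmod (lam (2 * k)))) =
      (\<Sum>k=1..m. (complex_of_real (r (2 * k - 1)) * lam (2 * k - 1) +
        complex_of_real (r (2 * k)) * lam (2 * k)) * a (cmod (lam (2 * k))))"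
    by (intro sum.cong refl) (simp only: pair_modulus distrib_right of_real_add)
  finally show ?thesis .
qed

end

end

section \<open>Characterisation of equal Jacobi parameters by circle data\<close>

theorem theorem5p1:
  fixes n m m' :: nat
    and r r' :: "nat \<Rightarrow> real"
    and lam lam' :: "nat \<Rightarrow> complex"
    and \<rho> \<rho>' :: "complex measure"
  assumes "n \<ge> 1"
    and "is_biradial n r lam \<rho>" and "modulus_ordered n m lam"
    and "is_biradial n r' lam' \<rho>'" and "modulus_ordered n m' lam'"
  shows "((\<forall>j\<in>{1..n}. jacobi_alpha \<rho> j = jacobi_alpha \<rho>' j) \<and>
          (\<forall>j\<in>{1..n - 1}. jacobi_beta \<rho> j = jacobi_beta \<rho>' j))
     \<longleftrightarrow>
         (m = m' \<and>
          (\<forall>k\<in>{2 * m + 1..n}. r k = r' k) \<and>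
          (\<forall>k\<in>{1..m}. r (2 * k - 1) + r (2 * k) = r' (2 * k - 1) + r' (2 * k)) \<and>
          (\<forall>k\<in>{2 * m + 1..n}. lam k = lam' k) \<and>
          (\<forall>k\<in>{1..m}. cmod (lam (2 * k)) = cmod (lam' (2 * k))) \<and>
          (\<forall>k\<in>{1..m}.
             complex_of_real (r (2 * k - 1)) * lam (2 * k - 1) + complex_of_real (r (2 * k)) * lam (2 * k)
           = complex_of_real (r' (2 * k - 1)) * lam' (2 * k - 1) + complex_of_real (r' (2 * k)) * lam' (2 * k)))" (is "?L \<longleftrightarrow> ?R")
proof -
  interpret biradial_pair n r lam \<rho> r' lam' \<rho>'
    using assms by unfold_locales auto
  note ord = assms(3) and ord' = assms(5)
  have "same_radial_integrals \<longleftrightarrow> ?R"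
  proof
    assume same: same_radial_integrals
    \<comment> \<open>Mass and moment at \<open>R\<close> are the integrals with \<open>a\<close>
      the indicator of the single radius \<open>R\<close>.\<close>
    have mass: "mass = B.mass"
    proof
      fix R
      have "complex_of_real (mass R) = complex_of_real (B.mass R)"
        unfolding mass_eq_ip B.mass_eq_ip
        using same [unfolded same_radial_integrals_def, THEN spec, of "\<lambda>x. if x = R then 1 else 0"]
        by blast
      then show "mass R = B.mass R" by simp
    qed
    have moment: "moment = B.moment"
    proof
      fix R
      show "moment R = B.moment R"
        unfolding moment_eq_ip B.moment_eq_ip
        using same [unfolded same_radial_integrals_def, THEN spec, of "\<lambda>x. if x = R then 1 else 0"]
        by blast
    qed
    \<comment> \<open>Both numbers count the radii at which the strict inequality between moment and
      mass holds.\<close>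
    have m: "m' = m"
      using card_pair_radii [OF ord] B.card_pair_radii [OF ord'] by (simp add: mass moment)
    note ord'' = ord' [unfolded m]
    \<comment> \<open>The radii of the pairs form the same set for both measures, and both orderings
      enumerate it increasingly.\<close>
    have pairs: "cmod (lam (2 * k)) = cmod (lam' (2 * k))" if "k \<in> {1..m}" for k
      using strict_mono_enumeration_unique [OF strict_mono_pairs [OF ord]
          B.strict_mono_pairs [OF ord''] _ that]
        pair_radii [OF ord] B.pair_radii [OF ord''] by (simp add: mass moment)
    have singles: "cmod (lam k) = cmod (lam' k)" if "k \<in> {2 * m + 1..n}" for k
      using strict_mono_enumeration_unique [OF strict_mono_singles [OF ord]
          B.strict_mono_singles [OF ord''] _ that]
        single_radii [OF ord] B.single_radii [OF ord''] by (simp add: mass moment)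
    have rs: "r k = r' k" if "k \<in> {2 * m + 1..n}" for k
      using mass_single [OF ord that] B.mass_single [OF ord'' that] singles [OF that]
      by (simp add: mass)
    have ls: "lam k = lam' k" if k: "k \<in> {2 * m + 1..n}" for k
    proof -
      have "complex_of_real (r k) * lam k = complex_of_real (r k) * lam' k"
        using moment_single [OF ord k] B.moment_single [OF ord'' k] singles [OF k] rs [OF k]
        by (simp only: moment)
      moreover have "r k \<noteq> 0" using weight_pos [of k] k by auto
      ultimately show ?thesis by simp
    qed
    have rp: "r (2 * k - 1) + r (2 * k) = r' (2 * k - 1) + r' (2 * k)" if "k \<in> {1..m}" for k
      using mass_pair [OF ord that] B.mass_pair [OF ord'' that] pairs [OF that] by (simp add: mass)
    have lp: "complex_of_real (r (2 * k - 1)) * lam (2 * k - 1) + complex_of_real (r (2 * k)) * lam (2 * k)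
           = complex_of_real (r' (2 * k - 1)) * lam' (2 * k - 1) + complex_of_real (r' (2 * k)) * lam' (2 * k)"
      if "k \<in> {1..m}" for k
      using moment_pair [OF ord that] B.moment_pair [OF ord'' that] pairs [OF that]
      by (simp add: moment)
    show ?R
      using m pairs rs ls rp lp by blast
  next
    assume R: ?R
    then have m: "m' = m" by simp
    note ord'' = ord' [unfolded m]
    show same_radial_integrals
      unfolding same_radial_integrals_def ip_radial_split [OF ord] B.ip_radial_split [OF ord'']
        ip_mult_radial_split [OF ord] B.ip_mult_radial_split [OF ord'']
      using R by (intro allI conjI arg_cong2 [of _ _ _ _ "(+)"] sum.cong) auto
  qed
  then show ?thesis
    using same_jacobi_iff by (simp only: same_jacobi_def)
qed

end
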